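(* Let $\varphi_e(z)=e^z$ and $\varphi_B(z)=\exp(e^z-1)$ for $z\in\mathbb D$. Then the sharp $\mathcal S^*(\varphi_B)$-radius of $\mathcal S^*(\varphi_e)$ is $$R_{\mathcal S^*(\varphi_B)}(\mathcal S^*(\varphi_e))=1-e^{-1}.$$
   Context: Let $\mathbb D=\{z\in\mathbb C:|z|<1\}$ and let $\mathcal A$ be the class of functions $f$ analytic on $\mathbb D$ with $f(0)=0$ and $f'(0)=1$. For an analytic function $\varphi$ on $\mathbb D$ with $\varphi(0)=1$, the class $\mathcal S^*(\varphi)$ consists of all $f\in\mathcal A$ with $zf'(z)/f(z)\prec\varphi(z)$; that is, there is an analytic $\omega:\mathbb D\to\mathbb D$ with $\omega(0)=0$ such that $zf'(z)/f(z)=\varphi(\omega(z))$ on $\mathbb D$ (the quotient takes the value $1$ at $z=0$, and $f$ has no other zeros). For two such functions $\varphi_1,\varphi_2$, the sharp $\mathcal S^*(\varphi_2)$-radius of $\mathcal S^*(\varphi_1)$ is $$R_{\mathcal S^*(\varphi_2)}(\mathcal S^*(\varphi_1))=\sup\left\{r\in(0,1]: f_r(z)=\tfrac{f(rz)}{r}\text{ belongs to }\mathcal S^*(\varphi_2)\text{ for every } f\in\mathcal S^*(\varphi_1)\right\}.$$ *)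

theory Defs
  imports "HOL-Complex_Analysis.Complex_Analysis"
begin

abbreviation unit_disc :: "complex set" (\<open>\<D>\<close>) where
  "\<D> \<equiv> ball 0 1"

definition normalized_analytic :: "(complex \<Rightarrow> complex) set" (\<open>\<A>\<close>) where
  "\<A> = {f. f holomorphic_on \<D> \<and> f 0 = 0 \<and> deriv f 0 = 1}"

definition subordinate :: "(complex \<Rightarrow> complex) \<Rightarrow> (complex \<Rightarrow> complex) \<Rightarrow> bool"
    (infix \<open>\<prec>\<^sub>s\<close> 50) where
  "g \<prec>\<^sub>s \<phi> \<longleftrightarrow>
     (\<exists>\<omega>. \<omega> holomorphic_on \<D> \<and> \<omega> ` \<D> \<subseteq> \<D> \<and> \<omega> 0 = 0 \<and> (\<forall>z\<in>\<D>. g z = \<phi> (\<omega> z)))"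

text \<open>The quotient \<open>z f'(z) / f(z)\<close>, with its removable singularity at \<open>0\<close> filled in
  (for \<open>f \<in> \<A>\<close> the limit there is \<open>1\<close>).\<close>

definition starlike_quotient :: "(complex \<Rightarrow> complex) \<Rightarrow> complex \<Rightarrow> complex" where
  "starlike_quotient f z = (if z = 0 then 1 else z * deriv f z / f z)"

text \<open>The class \<open>S\<^sup>*(\<phi>)\<close>, intended for \<open>\<phi>\<close> analytic on the unit disc with \<open>\<phi> 0 = 1\<close>.
  That \<open>f\<close> vanishes only at the origin is part of the requirement that the quotient be defined
  on the disc; it has to be stated because division is total.\<close>

definition starlike_class :: "(complex \<Rightarrow> complex) \<Rightarrow> (complex \<Rightarrow> complex) set" where
  "starlike_class \<phi> =
     {f \<in> \<A>. (\<forall>z\<in>\<D> - {0}. f z \<noteq> 0) \<and> starlike_quotient f \<prec>\<^sub>s \<phi>}"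

definition dilation :: "real \<Rightarrow> (complex \<Rightarrow> complex) \<Rightarrow> complex \<Rightarrow> complex" where
  "dilation r f z = f (of_real r * z) / of_real r"

text \<open>\<open>starlike_radius \<phi>\<^sub>2 \<phi>\<^sub>1\<close> is the sharp \<open>S\<^sup>*(\<phi>\<^sub>2)\<close>-radius of \<open>S\<^sup>*(\<phi>\<^sub>1)\<close>.\<close>

definition starlike_radius :: "(complex \<Rightarrow> complex) \<Rightarrow> (complex \<Rightarrow> complex) \<Rightarrow> real" where
  "starlike_radius \<phi>\<^sub>2 \<phi>\<^sub>1 =
     Sup {r. 0 < r \<and> r \<le> 1 \<and> (\<forall>f \<in> starlike_class \<phi>\<^sub>1. dilation r f \<in> starlike_class \<phi>\<^sub>2)}"

definition phi_e :: "complex \<Rightarrow> complex" where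
  "phi_e z = exp z"

definition phi_B :: "complex \<Rightarrow> complex" where
  "phi_B z = exp (exp z - 1)"

end

theory Submission
  imports Defs
begin

text \<open>If \<open>z f'/f = exp \<circ> \<omega>\<close>, the Schwarz function of \<open>f(r\<cdot>)/r\<close> with respect to
  \<open>phi_B\<close> is forced to be \<open>log (1 + \<omega>(r z))\<close>. The power series of the logarithm and the Schwarz lemma
  bound its modulus by \<open>- log (1 - r \<bar>z\<bar>)\<close>, which is less than \<open>1\<close> for \<open>r = 1 - 1/e\<close>.
  For \<open>\<omega>(z) = z\<close> and larger \<open>r\<close>, that bound is violated at \<open>z = -(1 - 1/e)/r\<close>.\<close>

text \<open>The n-th term of the series of \<open>Ln (1 + z)\<close> has modulus |z|^n / n, and at
  the point -|z| all terms are nonpositive reals. So the triangle inequality loses nothing there,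
  and the bound is attained for z in (-1, 0].\<close>

lemma norm_Ln_one_plus_le:
  fixes z :: complex
  assumes "norm z < 1"
  shows "norm (Ln (1 + z)) \<le> - ln (1 - norm z)"
proof -
  have c: "(\<lambda>n. - ((- z) ^ n) / of_nat n) sums Ln (1 + z)"
    by (rule Ln_series') (use assms in simp)
  have "(\<lambda>n. - ((- (- norm z)) ^ n) / real n) sums ln (1 + (- norm z))"
    by (rule ln_series') (use assms in simp)
  then have r: "(\<lambda>n. norm z ^ n / real n) sums - ln (1 - norm z)"
    using sums_minus by fastforce
  show ?thesis
    by (rule norm_sums_le[OF c r]) (simp add: norm_divide norm_power)
qed

lemma
  assumes f: "f holomorphic_on \<D>" and r: "0 < r" "r \<le> 1"
  shows dilation_holomorphic: "dilation r f holomorphic_on \<D>"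
    and deriv_dilation: "z \<in> \<D> \<Longrightarrow> deriv (dilation r f) z = deriv f (of_real r * z)"
proof -
  have mem: "of_real r * z \<in> \<D>" if "z \<in> \<D>" for z :: complex
    using that r mult_mono[of r 1 "norm z" 1] mult_left_le_one_le[of "norm z" r]
    by (simp add: norm_mult)
  have d: "(dilation r f has_field_derivative deriv f (of_real r * z)) (at z)"
    if "z \<in> \<D>" for z
  proof -
    have "(f has_field_derivative deriv f (of_real r * z)) (at (of_real r * z))"
      using f mem[OF that] holomorphic_derivI by blast
    then have "((\<lambda>z. f (of_real r * z)) has_field_derivative deriv f (of_real r * z) * of_real r) (at z)"
      by (rule DERIV_chain2[where g = "\<lambda>z. of_real r * z"]) (auto intro!: derivative_eq_intros)
    from DERIV_cdivide[OF this, of "of_real r"] show ?thesis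
      using r by (simp add: dilation_def[abs_def])
  qed
  show "dilation r f holomorphic_on \<D>"
    using d by (meson holomorphic_on_open open_ball)
  show "deriv (dilation r f) z = deriv f (of_real r * z)" if "z \<in> \<D>"
    using d[OF that] by (rule DERIV_imp_deriv)
qed

lemma starlike_quotient_dilation:
  assumes "f holomorphic_on \<D>" "0 < r" "r \<le> 1" "z \<in> \<D>"
  shows "starlike_quotient (dilation r f) z = starlike_quotient f (of_real r * z)"
  using assms by (simp add: starlike_quotient_def deriv_dilation) (simp add: dilation_def)

lemma dilation_in_starlike_class_phi_B:
  assumes f: "f \<in> starlike_class phi_e" and r: "0 < r" "r \<le> 1 - exp (-1)"
  shows "dilation r f \<in> starlike_class phi_B"
proof -
  have r1: "r < 1" using r(2) exp_gt_zero[of "-1::real"] by linarith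
  have hf: "f holomorphic_on \<D>" and f0: "f 0 = 0" and f1: "deriv f 0 = 1"
    and nz: "\<And>z. z \<in> \<D> - {0} \<Longrightarrow> f z \<noteq> 0"
    using f by (auto simp: starlike_class_def normalized_analytic_def)
  obtain \<omega> where hw: "\<omega> holomorphic_on \<D>" and wD: "\<omega> ` \<D> \<subseteq> \<D>" and w0: "\<omega> 0 = 0"
    and weq: "\<And>z. z \<in> \<D> \<Longrightarrow> starlike_quotient f z = exp (\<omega> z)"
    using f by (auto simp: starlike_class_def subordinate_def phi_e_def)
  have le: "norm (of_real r * z) < r" if "z \<in> \<D>" for z :: complex
    using that r by (simp add: norm_mult)
  have mem: "of_real r * z \<in> \<D>" if "z \<in> \<D>" for z :: complex
    using le[OF that] r1 by simp
  have sw: "norm (\<omega> z) \<le> norm z" if "z \<in> \<D>" for z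
    by (rule Schwarz_Lemma(1)[OF hw w0]) (use wD that in \<open>auto simp: image_subset_iff\<close>)
  \<comment> \<open>Strict because |z| < 1; this is what admits the endpoint r = 1 - 1/e
    below.\<close>
  have wr: "norm (\<omega> (of_real r * z)) < r" if "z \<in> \<D>" for z
    using sw[OF mem[OF that]] le[OF that] by linarith
  \<comment> \<open>The right half-plane avoids both 0 and the branch cut of \<open>Ln\<close>, so
    \<open>v\<close> will be holomorphic and \<open>exp (v z)\<close> will recover 1 + \<omega>(r
    z).\<close>
  have pos: "0 < Re (1 + \<omega> (of_real r * z))" if "z \<in> \<D>" for z
    using wr[OF that] r1 abs_Re_le_cmod[of "\<omega> (of_real r * z)"] by simp
  define v where "v = (\<lambda>z. Ln (1 + \<omega> (of_real r * z)))"
  have comp: "(\<lambda>z. \<omega> (of_real r * z)) holomorphic_on \<D>"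
    using holomorphic_on_compose_gen[OF _ hw, of "\<lambda>z. of_real r * z" \<D>] mem
    by (auto simp: o_def image_subset_iff intro!: holomorphic_intros)
  have hv: "v holomorphic_on \<D>"
    unfolding v_def using comp pos
    by (intro holomorphic_intros) (fastforce simp: complex_nonpos_Reals_iff)
  have v1: "v z \<in> \<D>" if "z \<in> \<D>" for z
  proof -
    let ?w = "\<omega> (of_real r * z)"
    have "exp (-1) < 1 - norm ?w" using wr[OF that] r(2) by linarith
    then have "-1 < ln (1 - norm ?w)"
      by (metis exp_gt_zero ln_exp ln_less_cancel_iff less_trans)
    moreover have "norm (v z) \<le> - ln (1 - norm ?w)"
      unfolding v_def by (rule norm_Ln_one_plus_le) (use wr[OF that] r1 in linarith)
    ultimately show ?thesis by simp
  qed
  have veq: "starlike_quotient (dilation r f) z = phi_B (v z)" if "z \<in> \<D>" for z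
  proof -
    have "1 + \<omega> (of_real r * z) \<noteq> 0"
      using pos[OF that] by (metis less_irrefl zero_complex.simps(1))
    then have "exp (v z) = 1 + \<omega> (of_real r * z)" by (simp add: v_def)
    then show ?thesis
      using that r1 r mem hf by (simp add: starlike_quotient_dilation weq phi_B_def)
  qed
  have "starlike_quotient (dilation r f) \<prec>\<^sub>s phi_B"
    unfolding subordinate_def using hv v1 veq w0
    by (intro exI[of _ v]) (auto simp: v_def)
  moreover have "dilation r f \<in> \<A>"
    using dilation_holomorphic[OF hf r(1)] deriv_dilation[OF hf r(1), of 0] r1 f0 f1
    by (simp add: normalized_analytic_def dilation_def)
  moreover have "dilation r f z \<noteq> 0" if "z \<in> \<D> - {0}" for z
    using nz[of "of_real r * z"] mem[of z] that r by (simp add: dilation_def)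
  ultimately show ?thesis by (simp add: starlike_class_def)
qed

text \<open>The Schwarz function is the identity here. Solving z f'/f = e^z gives f(z) = z
  exp(G(z)), where G is the primitive of (e^z - 1)/z with G(0) = 0.\<close>

lemma starlike_class_phi_e_extremal:
  obtains f where "f \<in> starlike_class phi_e"
    and "\<And>z. z \<in> \<D> \<Longrightarrow> starlike_quotient f z = exp z"
proof -
  define h where "h = (\<lambda>z::complex. if z = 0 then 1 else (exp z - 1) / z)"
  have hh: "h holomorphic_on \<D>"
  proof -
    \<comment> \<open>\<open>h\<close> is the difference quotient of e^z - 1 at 0, completed there
      by the derivative 1, so the singularity is removable.\<close>
    have "(\<lambda>z::complex. if z = 0 then deriv (\<lambda>z. exp z - 1) 0 else ((exp z - 1) - (exp 0 - 1)) / (z - 0))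
            holomorphic_on \<D>"
      by (rule pole_lemma_open) (auto intro!: holomorphic_intros)
    moreover have "deriv (\<lambda>z. exp z - 1) (0::complex) = 1"
      by (rule DERIV_imp_deriv) (auto intro!: derivative_eq_intros)
    ultimately show ?thesis by (simp add: h_def cong: if_cong)
  qed
  obtain G0 where G0: "\<And>z. z \<in> \<D> \<Longrightarrow> (G0 has_field_derivative h z) (at z)"
    using holomorphic_convex_primitive'[OF convex_ball open_ball hh]
    by (metis at_within_open open_ball)
  \<comment> \<open>Subtracting \<open>G0 0\<close> yields f'(0) = exp(G(0)) = 1.\<close>
  define G where "G = (\<lambda>z. G0 z - G0 0)"
  define f where "f = (\<lambda>z. z * exp (G z))"
  have G: "(G has_field_derivative h z) (at z)" if "z \<in> \<D>" for z
    unfolding G_def using G0[OF that] by (auto intro!: derivative_eq_intros)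
  \<comment> \<open>By the product rule f' = (1 + z G') exp(G) with G' = h, so this identity is the
    differential equation for f.\<close>
  have hz: "1 + z * h z = exp z" for z by (simp add: h_def)
  have fd: "(f has_field_derivative exp z * exp (G z)) (at z)" if "z \<in> \<D>" for z
    unfolding f_def hz[of z, symmetric] using G[OF that]
    by (auto intro!: derivative_eq_intros simp: algebra_simps)
  have fdz: "deriv f z = exp z * exp (G z)" if "z \<in> \<D>" for z
    using fd[OF that] by (rule DERIV_imp_deriv)
  have q: "starlike_quotient f z = exp z" if "z \<in> \<D>" for z
    using that fdz by (simp add: starlike_quotient_def f_def)
  have "f holomorphic_on \<D>"
    using fd by (meson holomorphic_on_open open_ball)
  moreover have "f 0 = 0" "deriv f 0 = 1" "\<forall>z\<in>\<D> - {0}. f z \<noteq> 0"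
    using fdz[of 0] by (auto simp: f_def G_def)
  moreover have "starlike_quotient f \<prec>\<^sub>s phi_e"
    unfolding subordinate_def phi_e_def using q
    by (intro exI[of _ "\<lambda>z. z"]) auto
  ultimately have "f \<in> starlike_class phi_e"
    by (simp add: starlike_class_def normalized_analytic_def)
  with q that show thesis by blast
qed

text \<open>At a suitable point the extremal function forces exp(v) = 1/e for the value v of the
  Schwarz function, whereas |v| < 1 gives Re v > -1 and hence |exp(v)| > 1/e.\<close>

lemma radius_le_of_dilation_in_starlike_class_phi_B:
  assumes r: "0 < r" "r \<le> 1"
    and all: "\<And>f. f \<in> starlike_class phi_e \<Longrightarrow> dilation r f \<in> starlike_class phi_B"
  shows "r \<le> 1 - exp (-1)"
proof (rule ccontr)
  assume "\<not> r \<le> 1 - exp (-1)"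
  then have big: "1 - exp (-1) < r" by simp
  have e1: "exp (-1) < (1::real)" by simp
  obtain f where f: "f \<in> starlike_class phi_e"
    and q: "\<And>z. z \<in> \<D> \<Longrightarrow> starlike_quotient f z = exp z"
    using starlike_class_phi_e_extremal by blast
  have hf: "f holomorphic_on \<D>"
    using f by (simp add: starlike_class_def normalized_analytic_def)
  \<comment> \<open>Chosen so that 1 + r t = 1/e; the assumption r > 1 - 1/e is exactly what puts t
    inside the disc.\<close>
  define t where "t = - ((1 - exp (-1)) / r)"
  define z where "z = complex_of_real t"
  have rt: "r * t = exp (-1) - 1" using r by (simp add: t_def)
  then have rz: "of_real r * z = of_real (exp (-1) - 1)"
    unfolding z_def by (metis of_real_mult)
  have "0 \<le> (1 - exp (-1)) / r" "(1 - exp (-1)) / r < 1" using r big by simp_all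
  then have "\<bar>t\<bar> < 1" unfolding t_def by linarith
  then have zD: "z \<in> \<D>" by (simp add: z_def)
  have rzD: "of_real r * z \<in> \<D>"
    unfolding rz using e1 exp_gt_zero[of "-1::real"] by (simp del: of_real_diff exp_gt_zero)
  obtain v where v: "norm v < 1" "starlike_quotient (dilation r f) z = phi_B v"
    using all[OF f] zD by (force simp: starlike_class_def subordinate_def)
  have "exp (of_real r * z) = exp (exp v - 1)"
    using v(2) starlike_quotient_dilation[OF hf r zD] q[OF rzD] by (simp add: phi_B_def)
  then have E: "exp (exp v - 1) = exp (complex_of_real (exp (-1) - 1))"
    unfolding rz by simp
  \<comment> \<open>\<open>\<bar>exp v\<bar> < e < 2 \<pi>\<close> excludes the other logarithms.\<close>
  have "\<bar>Re v\<bar> < 1" using v(1) abs_Re_le_cmod[of v] by linarith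
  then have "norm (exp v) < exp 1" and lower: "exp (-1) < norm (exp v)" by simp_all
  then have "\<bar>Im (exp v)\<bar> < 3"
    using abs_Im_le_cmod[of "exp v"] exp_le by linarith
  then have "exp v - 1 = complex_of_real (exp (-1) - 1)"
    by (intro exp_complex_eqI[OF _ E]) (use pi_gt3 in simp)
  then have "exp v = complex_of_real (exp (-1))" by simp
  then have "norm (exp v) = exp (-1)" by (metis abs_exp_cancel norm_of_real)
  with lower show False by simp
qed

theorem theorem7p6:
  shows "starlike_radius phi_B phi_e = 1 - exp (-1)"
  unfolding starlike_radius_def
  \<comment> \<open>The supremum is attained: 1 - 1/e is itself admissible, and it bounds every
    admissible r.\<close>
  by (rule cSup_eq_maximum)
    (auto intro: dilation_in_starlike_class_phi_B radius_le_of_dilation_in_starlike_class_phi_B)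

end
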